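(* Let $n\ge 2$ and let $$A=\begin{bmatrix}1&0&0&\cdots&x_1\\0&1&0&\cdots&x_2\\0&0&\ddots&\vdots&\vdots\\0&0&\cdots&1&x_{n-1}\\0&0&\cdots&0&x_n\end{bmatrix}$$ be the real $n\times n$ upper triangular matrix whose first $n-1$ columns are the standard basis vectors $e_1,\dots,e_{n-1}$ and whose last column is $(x_1,\dots,x_n)^T$, where $\sum_{i=1}^n x_i^2=1$, $x_i\ge 0$ for $1\le i<n$, and $x_n<0$. Set $X_0=A$ and let $X_1,X_2,\dots$ be a sequence of real $n\times n$ matrices such that, for every $k\ge 0$, $X_{k+1}$ is an eigenvector matrix of $X_k$ whose first $n-1$ columns are $e_1,\dots,e_{n-1}$ and whose last column $y=(y_1,\dots,y_n)^T$ satisfies $$X_k\,y=(X_k)_{nn}\,y,\qquad \sum_{i=1}^n y_i^2=1,\qquad y_i\ge 0\ \text{ for }1\le i<n,\qquad y_n<0.$$ Then $$\lim_{k\to\infty}X_k=\begin{bmatrix}1&0&0&\cdots&0\\0&1&0&\cdots&0\\0&0&\ddots&\vdots&\vdots\\0&0&\cdots&1&0\\0&0&\cdots&0&-1\end{bmatrix}=\operatorname{diag}(1,\dots,1,-1).$$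
   Context: An eigenvector matrix of an $n\times n$ matrix $M$ is an invertible $n\times n$ matrix $X$ whose columns are eigenvectors of $M$, each of unit Euclidean ($\mathcal L_2$) norm. Here $(X_k)_{nn}$ denotes the bottom-right entry of $X_k$. *)

theory Defs
  imports "HOL-Analysis.Analysis"
begin

text \<open>Rows and columns are indexed by a finite linearly ordered type \<open>'n\<close>, whose elements in
  increasing order play the role of the indices \<open>1, \<dots>, n\<close>.\<close>

definition last_index :: "'n :: {finite, linorder}" where
  "last_index = Max UNIV"

definition eigenvector :: "real ^ 'n ^ 'n \<Rightarrow> real ^ 'n \<Rightarrow> bool" where
  "eigenvector M v \<longleftrightarrow> v \<noteq> 0 \<and> (\<exists>c. M *v v = c *s v)"

definition eigenvector_matrix :: "real ^ 'n ^ 'n \<Rightarrow> real ^ 'n ^ 'n \<Rightarrow> bool" where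
  "eigenvector_matrix M X \<longleftrightarrow>
     invertible X \<and> (\<forall>j. eigenvector M (column j X) \<and> norm (column j X) = 1)"

definition identity_with_last_column ::
    "real ^ ('n :: {finite, linorder}) \<Rightarrow> real ^ ('n :: {finite, linorder}) ^ ('n :: {finite, linorder})" where
  "identity_with_last_column x =
     (\<chi> i j. if j = last_index then x $ i else if i = j then 1 else 0)"

definition diagonal_matrix :: "('n \<Rightarrow> real) \<Rightarrow> real ^ 'n ^ 'n" where
  "diagonal_matrix d = (\<chi> i j. if i = j then d i else 0)"

end

theory Submission
  imports Defs
begin

text \<open>If the last column of \<open>X\<^sub>k\<close> is a unit vector with last entry \<open>- cos \<theta>\<close>, then the eigenvector
  equation together with normalisation forces the last entry of the next column to be
  \<open>- cos (\<theta>/2)\<close>. Hence the squared norm \<open>sin\<^sup>2 \<theta>\<close> of the remaining entries is at least halved at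
  each step and tends to \<open>0\<close>.\<close>

lemma less_last_index_iff: "i < last_index \<longleftrightarrow> i \<noteq> (last_index :: 'n :: {finite, linorder})"
proof -
  have "i \<le> last_index" unfolding last_index_def by simp
  then show ?thesis by auto
qed

lemma identity_with_last_column_mult_nth:
  fixes v y :: "real ^ ('n :: {finite, linorder})"
  assumes "i \<noteq> last_index"
  shows "(identity_with_last_column v *v y) $ i = y $ i + v $ i * y $ last_index"
proof -
  have "(identity_with_last_column v *v y) $ i =
      (\<Sum>j\<in>UNIV. (if j = last_index then v $ i * y $ last_index else 0) + (if i = j then y $ i else 0))"
    unfolding matrix_vector_mult_def identity_with_last_column_def
    using assms by (auto intro!: sum.cong)
  also have "\<dots> = y $ i + v $ i * y $ last_index"
    by (simp add: sum.distrib)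
  finally show ?thesis .
qed

text \<open>Reduces the matrix iteration to one on vectors: each \<open>X k\<close> is determined by
  its last column.\<close>

lemma eq_identity_with_last_column:
  fixes M :: "real ^ ('n :: {finite, linorder}) ^ ('n :: {finite, linorder})"
  assumes "\<And>j. j < last_index \<Longrightarrow> column j M = axis j 1"
  shows "M = identity_with_last_column (column last_index M)"
proof -
  have "M $ i $ j = (if i = j then 1 else 0)" if "j \<noteq> last_index" for i j
    using arg_cong[OF assms[of j], of "\<lambda>v. v $ i"] that
    by (simp add: less_last_index_iff column_def axis_def eq_commute)
  then show ?thesis
    by (auto simp: vec_eq_iff identity_with_last_column_def column_def)
qed

lemma column_last_index_identity [simp]:
  "column last_index (identity_with_last_column v) = v"
  by (simp add: vec_eq_iff column_def identity_with_last_column_def)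

lemma sum_squares_last_index:
  fixes v :: "real ^ ('n :: {finite, linorder})"
  shows "(\<Sum>i\<in>UNIV. (v $ i)\<^sup>2) = (v $ last_index)\<^sup>2 + (\<Sum>i\<in>UNIV - {last_index}. (v $ i)\<^sup>2)"
  by (rule sum.remove) auto

text \<open>Off the last index the eigenvector equation makes \<open>y\<close> proportional to
  \<open>v\<close>, so with both norms equal to 1 the left-hand sum is a function of
  \<open>v $ last_index\<close> alone, namely half of \<open>1 + v $ last_index\<close>.\<close>

lemma off_last_halved:
  fixes v y :: "real ^ ('n :: {finite, linorder})"
  assumes eigen: "identity_with_last_column v *v y = (v $ last_index) *s y"
    and v1: "(\<Sum>i\<in>UNIV. (v $ i)\<^sup>2) = 1" and y1: "(\<Sum>i\<in>UNIV. (y $ i)\<^sup>2) = 1"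
    and neg: "v $ last_index < 0"
  shows "(\<Sum>i\<in>UNIV - {last_index}. (y $ i)\<^sup>2) \<le> (\<Sum>i\<in>UNIV - {last_index}. (v $ i)\<^sup>2) / 2"
proof -
  define a where "a = - v $ last_index"
  define b where "b = - y $ last_index"
  define s where "s = (\<Sum>i\<in>UNIV - {last_index}. (v $ i)\<^sup>2)"
  define t where "t = (\<Sum>i\<in>UNIV - {last_index}. (y $ i)\<^sup>2)"
  have s: "s = 1 - a\<^sup>2"
    using v1 unfolding sum_squares_last_index s_def a_def by simp
  have b: "b\<^sup>2 = 1 - t"
    using y1 unfolding sum_squares_last_index t_def b_def by simp
  have a: "0 < a" "a \<le> 1"
  proof -
    show "0 < a" using neg by (simp add: a_def)
    have "s \<ge> 0" unfolding s_def by (rule sum_nonneg) simp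
    then have "a\<^sup>2 \<le> 1\<^sup>2" using s by simp
    then show "a \<le> 1" by (rule power2_le_imp_le) simp
  qed
  \<comment> \<open>Coordinate \<open>i\<close> of the eigenvector equation reads
    \<open>y $ i - b * v $ i = - a * y $ i\<close>.\<close>
  have entry: "(1 + a) * y $ i = b * v $ i" if "i \<noteq> last_index" for i
    using arg_cong[OF eigen, of "\<lambda>w. w $ i"] identity_with_last_column_mult_nth[OF that, of v y]
    by (simp add: a_def b_def algebra_simps)
  \<comment> \<open>Squaring and summing \<open>entry\<close> leaves one scalar equation in
    \<open>a\<close> and \<open>t\<close>.\<close>
  have "(1 + a)\<^sup>2 * t = (\<Sum>i\<in>UNIV - {last_index}. ((1 + a) * y $ i)\<^sup>2)"
    by (simp add: t_def sum_distrib_left power_mult_distrib)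
  also have "\<dots> = (\<Sum>i\<in>UNIV - {last_index}. (b * v $ i)\<^sup>2)"
    by (rule sum.cong) (auto simp: entry)
  also have "\<dots> = b\<^sup>2 * s"
    by (simp add: s_def sum_distrib_left power_mult_distrib)
  also have "\<dots> = (1 - t) * ((1 - a) * (1 + a))"
    unfolding b s by (simp add: power2_eq_square algebra_simps)
  finally have "(1 + a) * ((1 + a) * t) = (1 + a) * ((1 - t) * (1 - a))"
    by (simp add: power2_eq_square mult_ac)
  then have "(1 + a) * t = (1 - t) * (1 - a)"
    using a by simp
  \<comment> \<open>The products \<open>a * t\<close> cancel; what remains is the half-angle
    formula.\<close>
  then have "2 * t = 1 - a"
    by (simp add: algebra_simps)
  also have "\<dots> \<le> s"
  proof -
    have "a * a \<le> a * 1" using a by (intro mult_left_mono) auto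
    then show ?thesis by (simp add: s power2_eq_square)
  qed
  finally show ?thesis by (simp add: s_def t_def)
qed

theorem theorem3p2:
  fixes x :: "real ^ ('n :: {finite, linorder})"
    and A :: "real ^ ('n :: {finite, linorder}) ^ ('n :: {finite, linorder})"
    and X :: "nat \<Rightarrow> real ^ ('n :: {finite, linorder}) ^ ('n :: {finite, linorder})"
  assumes "CARD('n) \<ge> 2"
    and "A = identity_with_last_column x"
    and "(\<Sum>i\<in>UNIV. (x $ i)\<^sup>2) = 1"
    and "\<And>i. i < last_index \<Longrightarrow> x $ i \<ge> 0"
    and "x $ last_index < 0"
    and "X 0 = A"
    and "\<And>k. eigenvector_matrix (X k) (X (Suc k))"
    and "\<And>k j. j < last_index \<Longrightarrow> column j (X (Suc k)) = axis j 1"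
    and "\<And>k y. y = column last_index (X (Suc k)) \<Longrightarrow>
           X k *v y = (X k $ last_index $ last_index) *s y \<and>
           (\<Sum>i\<in>UNIV. (y $ i)\<^sup>2) = 1 \<and>
           (\<forall>i<last_index. y $ i \<ge> 0) \<and>
           y $ last_index < 0"
  shows "X \<longlonglongrightarrow> diagonal_matrix (\<lambda>i. if i = last_index then -1 else 1)"
proof -
  define v where "v = (\<lambda>k. column last_index (X k))"
  define s where "s = (\<lambda>k. \<Sum>i\<in>UNIV - {last_index :: 'n}. (v k $ i)\<^sup>2)"
  have X_eq: "X k = identity_with_last_column (v k)" for k
  proof (cases k)
    case 0
    then show ?thesis using assms(2,6) by (simp add: v_def)
  next
    case (Suc m)
    then show ?thesis
      unfolding v_def using eq_identity_with_last_column[OF assms(8)] by blast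
  qed
  have v_unit: "(\<Sum>i\<in>UNIV. (v k $ i)\<^sup>2) = 1" and v_neg: "v k $ last_index < 0" for k
    \<comment> \<open>For \<open>k = 0\<close> the facts come from \<open>x\<close>; for a successor
      they come from the step that produced \<open>X k\<close>, hence the index
      \<open>k - 1\<close>.\<close>
    using assms(2,3,5,6) assms(9)[OF refl, of "k - 1"] by (cases k; simp add: v_def)+
  have v_le: "(v k $ i)\<^sup>2 \<le> s k" if "i \<noteq> last_index" for k i
    unfolding s_def using that by (intro member_le_sum) auto
  have s_nonneg: "0 \<le> s k" for k
    unfolding s_def by (rule sum_nonneg) simp
  have s_step: "s (Suc k) \<le> s k / 2" for k
    unfolding s_def
  proof (rule off_last_halved[OF _ v_unit v_unit v_neg])
    show "identity_with_last_column (v k) *v v (Suc k) = (v k $ last_index) *s v (Suc k)"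
      \<comment> \<open>The prescribed eigenvalue, the bottom-right entry of \<open>X k\<close>, is
        the last entry of \<open>v k\<close>.\<close>
      using assms(9)[OF refl, of k] by (simp add: X_eq[symmetric]) (simp add: v_def column_def)
  qed
  have s_le: "s k \<le> s 0 * (1 / 2) ^ k" for k
  proof (induction k)
    case (Suc k)
    then show ?case using s_step[of k] by simp
  qed simp
  have geometric: "(\<lambda>k. s 0 * (1 / 2) ^ k) \<longlonglongrightarrow> 0"
    by (intro tendsto_mult_right_zero LIMSEQ_power_zero) simp
  have s_lim: "s \<longlonglongrightarrow> 0"
    using s_nonneg s_le by (intro tendsto_sandwich[OF _ _ tendsto_const geometric]) auto
  have off: "(\<lambda>k. v k $ i) \<longlonglongrightarrow> 0" if "i \<noteq> last_index" for i
  proof -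
    have "(\<lambda>k. (v k $ i)\<^sup>2) \<longlonglongrightarrow> 0"
      using v_le[OF that] by (intro tendsto_sandwich[OF _ _ tendsto_const s_lim]) auto
    then show ?thesis by simp
  qed
  \<comment> \<open>The unit norm fixes only the square of the last entry; its negative sign selects
    the root, and so the limit -1 rather than 1.\<close>
  have "v k $ last_index = - sqrt (1 - s k)" for k
  proof -
    have "1 - s k = (v k $ last_index)\<^sup>2"
      using v_unit[of k] unfolding sum_squares_last_index s_def by simp
    then show ?thesis using v_neg[of k] by simp
  qed
  moreover have "(\<lambda>k. - sqrt (1 - s k)) \<longlonglongrightarrow> - sqrt (1 - 0)"
    by (intro tendsto_intros s_lim)
  ultimately have last: "(\<lambda>k. v k $ last_index) \<longlonglongrightarrow> -1"
    by simp
  show ?thesis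
  \<comment> \<open>Convergence is checked entrywise: all columns but the last are constant in
    \<open>k\<close>.\<close>
  proof (intro vec_tendstoI)
    fix i j :: 'n
    have "X k $ i $ j = (if j = last_index then v k $ i else if i = j then 1 else 0)" for k
      by (subst X_eq) (simp add: identity_with_last_column_def)
    then show "(\<lambda>k. X k $ i $ j) \<longlonglongrightarrow>
        diagonal_matrix (\<lambda>i. if i = last_index then -1 else 1) $ i $ j"
      using off[of i] last by (auto simp: diagonal_matrix_def)
  qed
qed

end
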